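(* Let $\mathcal{O}\subset\mathbb{R}^d$ be a bounded domain, $T>0$, $\mathcal{O}_T=\mathcal{O}\times(0,T)$, $p,q\ge2$, $\mu_1>0$, $\mu_2\ge0$, $\nu\ge0$, $\tau_\ast\ge0$, $\widehat\tau_\ast=\tau_\ast/\max(1,\sqrt[q]{\nu})$, and let $\Omega=\Omega(x,t)$ be a matrix function on $\mathcal{O}_T$ with antisymmetric values in $\mathbb{R}^{d\times d}$. Let $$V_{(x,t)}(X)=\frac{\mu_1}{p}|X_s|^p+\frac{\mu_2}{p}|X_a-\Omega(x,t)|^p+\widehat\tau_\ast\sqrt[q]{|X_s|^q+\nu|X_a-\Omega(x,t)|^q},\qquad X\in\mathbb{R}^{d\times d}.$$ Let $\mathrm{B}=\nabla\mathbf{v}$ be the gradient of a vector field $\mathbf{v}:\mathcal{O}_T\to\mathbb{R}^d$ and let $\mathbb{S}:\mathcal{O}_T\to\mathbb{R}^{d\times d}$ satisfy $\mathbb{S}(x,t)\in\partial V_{(x,t)}(\mathrm{B}(x,t))$, i.e. $$V_{(x,t)}(X)-V_{(x,t)}(\mathrm{B}(x,t))\geqslant\mathbb{S}(x,t):(X-\mathrm{B}(x,t)),\qquad\forall X\in\mathbb{R}^{d\times d},$$ for almost all $(x,t)\in\mathcal{O}_T$. If $\nu>0$ or $\nu=\mu_2=0$, then for almost all $(x,t)\in\mathcal{O}_T$ $$\begin{cases}\mathbb{S}=\mathrm{B}_{\mu,p}+\widehat\tau_\ast\dfrac{\mathrm{B}_{\nu,q}}{|\mathrm{B}^{\widehat{\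 }}_{\nu,q}|^{\frac{2(q-1)}{q}}},&\text{if }\mathrm{B}_\nu\neq0,\\[2mm] |\mathbb{S}|\leqslant\tau_\ast,&\text{if }\mathrm{B}_\nu=0.\end{cases}$$
   Context: For $X,Y\in\mathbb{R}^{d\times d}$: $X:Y=\sum_{i,j}X_{ij}Y_{ij}$, $|X|=\sqrt{X:X}$, $X_s=\frac12(X+X^{T})$, $X_a=\frac12(X-X^{T})$. $\nabla\mathbf{v}$ is the spatial gradient. With $\mathrm{R}=\mathrm{B}_a-\Omega$: $\mathrm{B}_\nu=\mathrm{B}_s+\nu\mathrm{R}$, $\mathrm{B}_{\mu,p}=\mu_1|\mathrm{B}_s|^{p-2}\mathrm{B}_s+\mu_2|\mathrm{R}|^{p-2}\mathrm{R}$, $\mathrm{B}_{\nu,q}=|\mathrm{B}_s|^{q-2}\mathrm{B}_s+\nu|\mathrm{R}|^{q-2}\mathrm{R}$, $\mathrm{B}^{\widehat{\ }}_{\nu,q}=|\mathrm{B}_s|^{\frac{q-2}{2}}\mathrm{B}_s+\sqrt{\nu}\,|\mathrm{R}|^{\frac{q-2}{2}}\mathrm{R}$. *)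

theory Defs
  imports "HOL-Analysis.Analysis"
begin

text \<open>
  Matrices are elements of the type \<open>real^'d^'d\<close>, whose library inner product and norm are
  the Frobenius ones. All powers with real exponents are written with \<open>powr\<close>; since
  \<open>0 powr a = 0\<close>, the factors \<open>|X|^(p-2)\<close> below are harmless at \<open>X = 0\<close>, where they multiply
  the zero matrix.
\<close>

lemma inner_matrix_eq_sum:
  fixes X Y :: "real^'d^'d"
  shows "X \<bullet> Y = (\<Sum>i\<in>UNIV. \<Sum>j\<in>UNIV. X $ i $ j * Y $ i $ j)"
  by (simp add: inner_vec_def)

lemma norm_matrix_eq_sqrt_sum:
  fixes X :: "real^'d^'d"
  shows "norm X = sqrt (\<Sum>i\<in>UNIV. \<Sum>j\<in>UNIV. (X $ i $ j)\<^sup>2)"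
  by (simp add: norm_eq_sqrt_inner inner_matrix_eq_sum power2_eq_square)

definition sym_part :: "real^'d^'d \<Rightarrow> real^'d^'d" where
  "sym_part X = (1/2) *\<^sub>R (X + transpose X)"

definition asym_part :: "real^'d^'d \<Rightarrow> real^'d^'d" where
  "asym_part X = (1/2) *\<^sub>R (X - transpose X)"

definition subdifferential :: "('a::real_inner \<Rightarrow> real) \<Rightarrow> 'a \<Rightarrow> 'a set" where
  "subdifferential f x = {s. \<forall>y. f y - f x \<ge> s \<bullet> (y - x)}"


subsection \<open>The spatial gradient\<close>

text \<open>
  Convention: the entry in row \<open>i\<close> and column \<open>j\<close> of the gradient is the derivative of the
  \<open>i\<close>-th component of the field in the direction of the \<open>j\<close>-th space variable.
\<close>

definition classical_gradient_on ::
  "((real^'d) \<times> real) set \<Rightarrow> ((real^'d) \<times> real \<Rightarrow> real^'d) \<Rightarrow> ((real^'d) \<times> real \<Rightarrow> real^'d^'d) \<Rightarrow> bool"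
where
  "classical_gradient_on Q v G \<longleftrightarrow>
     (\<forall>(x, t)\<in>Q. ((\<lambda>y. v (y, t)) has_derivative (\<lambda>h. G (x, t) *v h)) (at x))"

primrec C_k :: "nat \<Rightarrow> ('a::euclidean_space \<Rightarrow> real) \<Rightarrow> bool" where
  "C_k 0 f \<longleftrightarrow> continuous_on UNIV f"
| "C_k (Suc k) f \<longleftrightarrow>
     (\<forall>x. f differentiable (at x)) \<and> (\<forall>b\<in>Basis. C_k k (\<lambda>x. frechet_derivative f (at x) b))"

definition test_function :: "'a::euclidean_space set \<Rightarrow> ('a \<Rightarrow> real) \<Rightarrow> bool" where
  "test_function Q \<phi> \<longleftrightarrow>
     (\<forall>k. C_k k \<phi>) \<and> compact (closure {z. \<phi> z \<noteq> 0}) \<and> closure {z. \<phi> z \<noteq> 0} \<subseteq> Q"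

definition locally_integrable_on ::
  "'a::euclidean_space set \<Rightarrow> ('a \<Rightarrow> 'b::euclidean_space) \<Rightarrow> bool"
where
  "locally_integrable_on Q f \<longleftrightarrow> (\<forall>K. compact K \<and> K \<subseteq> Q \<longrightarrow> f absolutely_integrable_on K)"

definition weak_gradient_on ::
  "((real^'d) \<times> real) set \<Rightarrow> ((real^'d) \<times> real \<Rightarrow> real^'d) \<Rightarrow> ((real^'d) \<times> real \<Rightarrow> real^'d^'d) \<Rightarrow> bool"
where
  "weak_gradient_on Q v G \<longleftrightarrow>
     locally_integrable_on Q v \<and> locally_integrable_on Q G \<and>
     (\<forall>\<phi> i j. test_function Q \<phi> \<longrightarrow>
        (LINT z:Q|lebesgue. v z $ i * frechet_derivative \<phi> (at z) (axis j 1, 0))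
        = - (LINT z:Q|lebesgue. G z $ i $ j * \<phi> z))"

text \<open>
  No regularity of the field is prescribed, so both the pointwise and the distributional
  gradient are admitted.
\<close>

definition spatial_gradient_on ::
  "((real^'d) \<times> real) set \<Rightarrow> ((real^'d) \<times> real \<Rightarrow> real^'d) \<Rightarrow> ((real^'d) \<times> real \<Rightarrow> real^'d^'d) \<Rightarrow> bool"
where
  "spatial_gradient_on Q v G \<longleftrightarrow> classical_gradient_on Q v G \<or> weak_gradient_on Q v G"


subsection \<open>The potential and the matrices in the constitutive law\<close>

text \<open>Here \<open>W\<close> stands for the value \<open>\<Omega>(x,t)\<close> and \<open>B\<close> for the value of the gradient at \<open>(x,t)\<close>.\<close>

definition tau_hat :: "real \<Rightarrow> real \<Rightarrow> real \<Rightarrow> real" where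
  "tau_hat \<tau> \<nu> q = \<tau> / max 1 (\<nu> powr (1 / q))"

definition potential ::
  "real \<Rightarrow> real \<Rightarrow> real \<Rightarrow> real \<Rightarrow> real \<Rightarrow> real \<Rightarrow> real^'d^'d \<Rightarrow> real^'d^'d \<Rightarrow> real"
where
  "potential p q \<mu>\<^sub>1 \<mu>\<^sub>2 \<nu> \<tau> W X =
     \<mu>\<^sub>1 / p * norm (sym_part X) powr p
     + \<mu>\<^sub>2 / p * norm (asym_part X - W) powr p
     + tau_hat \<tau> \<nu> q *
       (norm (sym_part X) powr q + \<nu> * norm (asym_part X - W) powr q) powr (1 / q)"

definition rel_rot :: "real^'d^'d \<Rightarrow> real^'d^'d \<Rightarrow> real^'d^'d" where
  "rel_rot W B = asym_part B - W"

definition B_nu :: "real \<Rightarrow> real^'d^'d \<Rightarrow> real^'d^'d \<Rightarrow> real^'d^'d" where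
  "B_nu \<nu> W B = sym_part B + \<nu> *\<^sub>R rel_rot W B"

definition B_mu_p :: "real \<Rightarrow> real \<Rightarrow> real \<Rightarrow> real^'d^'d \<Rightarrow> real^'d^'d \<Rightarrow> real^'d^'d" where
  "B_mu_p \<mu>\<^sub>1 \<mu>\<^sub>2 p W B =
     (\<mu>\<^sub>1 * norm (sym_part B) powr (p - 2)) *\<^sub>R sym_part B
     + (\<mu>\<^sub>2 * norm (rel_rot W B) powr (p - 2)) *\<^sub>R rel_rot W B"

definition B_nu_q :: "real \<Rightarrow> real \<Rightarrow> real^'d^'d \<Rightarrow> real^'d^'d \<Rightarrow> real^'d^'d" where
  "B_nu_q \<nu> q W B =
     norm (sym_part B) powr (q - 2) *\<^sub>R sym_part B
     + (\<nu> * norm (rel_rot W B) powr (q - 2)) *\<^sub>R rel_rot W B"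

definition B_hat_nu_q :: "real \<Rightarrow> real \<Rightarrow> real^'d^'d \<Rightarrow> real^'d^'d \<Rightarrow> real^'d^'d" where
  "B_hat_nu_q \<nu> q W B =
     norm (sym_part B) powr ((q - 2) / 2) *\<^sub>R sym_part B
     + (sqrt \<nu> * norm (rel_rot W B) powr ((q - 2) / 2)) *\<^sub>R rel_rot W B"

end

theory Submission
  imports Defs
begin

text \<open>
  The claim is pointwise. Where the argument of the \<open>q\<close>-th root is positive, the potential is
  differentiable, so its only subgradient is its gradient, which is the stated formula. Where
  \<open>B_nu\<close> vanishes, the potential at \<open>B + t H\<close> equals \<open>t N(H) + O(t\<^sup>p)\<close> with the one-homogeneous
  \<open>N(H) = tau_hat (|H_s|\<^sup>q + \<nu> |H_a|\<^sup>q)\<^sup>1\<^sup>/\<^sup>q\<close>. Dividing the subgradient inequality by \<open>t\<close>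
  and letting \<open>t\<close> tend to \<open>0\<close> gives \<open>S \<bullet> H \<le> N(H)\<close>; the choice \<open>H = S\<close> yields the bound, since
  the \<open>\<ell>\<^sup>q\<close> norm on the plane is at most the \<open>\<ell>\<^sup>2\<close> norm for \<open>q \<ge> 2\<close>.
\<close>

section \<open>Orthogonality of symmetric and antisymmetric matrices\<close>

lemma inner_transpose_left:
  fixes X Y :: "real^'d^'d"
  shows "transpose X \<bullet> Y = X \<bullet> transpose Y"
  unfolding inner_matrix_eq_sum transpose_def
  by (simp, subst sum.swap, simp)

lemma transpose_add [simp]:
  fixes X Y :: "'a::ab_group_add^'n^'m"
  shows "transpose (X + Y) = transpose X + transpose Y"
  by (simp add: transpose_def vec_eq_iff)

lemma transpose_diff [simp]:
  fixes X Y :: "'a::ab_group_add^'n^'m"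
  shows "transpose (X - Y) = transpose X - transpose Y"
  by (simp add: transpose_def vec_eq_iff)

lemma bounded_linear_sym_part: "bounded_linear (sym_part :: real^'d^'d \<Rightarrow> _)"
  unfolding linear_conv_bounded_linear[symmetric]
  by (rule linearI) (simp_all add: sym_part_def transpose_scalar algebra_simps)

lemma bounded_linear_asym_part: "bounded_linear (asym_part :: real^'d^'d \<Rightarrow> _)"
  unfolding linear_conv_bounded_linear[symmetric]
  by (rule linearI) (simp_all add: asym_part_def transpose_scalar algebra_simps)

lemma transpose_sym_part [simp]: "transpose (sym_part X) = sym_part X"
  by (simp add: sym_part_def transpose_scalar algebra_simps)

lemma transpose_asym_part [simp]: "transpose (asym_part X) = - asym_part X"
  by (simp add: asym_part_def transpose_scalar algebra_simps)

lemma sym_part_plus_asym_part: "sym_part X + asym_part X = X"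
  by (simp add: sym_part_def asym_part_def algebra_simps flip: scaleR_add_left)

text \<open>Transposition is self-adjoint and fixes \<open>A\<close>, so both halves of
  \<open>sym_part H\<close> pair equally with \<open>A\<close>. This and its antisymmetric
  counterpart turn derivatives along the parts of a direction \<open>h\<close> into inner products
  with \<open>h\<close> itself.\<close>

lemma inner_sym_part:
  assumes "transpose A = A"
  shows "A \<bullet> sym_part H = A \<bullet> H"
  using inner_transpose_left[of A H] assms
  by (simp add: sym_part_def inner_add_right)

lemma inner_asym_part:
  assumes "transpose A = - A"
  shows "A \<bullet> asym_part H = A \<bullet> H"
  using inner_transpose_left[of A H] assms
  by (simp add: asym_part_def inner_diff_right)

text \<open>Moving the transpose across the inner product shows that \<open>A \<bullet> R\<close>
  equals its own negative.\<close>

lemma inner_symmetric_antisymmetric: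
  fixes A R :: "real^'d^'d"
  assumes "transpose A = A" "transpose R = - R"
  shows "A \<bullet> R = 0"
  using inner_transpose_left[of A R] assms by simp

lemma norm_symmetric_plus_antisymmetric:
  fixes A R :: "real^'d^'d"
  assumes "transpose A = A" "transpose R = - R"
  shows "(norm (a *\<^sub>R A + b *\<^sub>R R))\<^sup>2 = (a * norm A)\<^sup>2 + (b * norm R)\<^sup>2"
  using inner_symmetric_antisymmetric[OF assms]
  by (simp add: norm_add_Pythagorean orthogonal_def power_mult_distrib)

section \<open>Derivative of the potential and uniqueness of the subgradient\<close>

lemma has_derivative_norm_powr:
  fixes x :: "'a::real_inner"
  assumes "p > 1"
  shows "((\<lambda>x. norm x powr p) has_derivative (\<lambda>h. p * norm x powr (p - 2) * (x \<bullet> h))) (at x)"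
proof (cases "x = 0")
  case True
  \<comment> \<open>At the origin the claimed derivative is zero, and the difference quotient is
    \<open>norm h powr (p - 1)\<close>, which vanishes in the limit because
    \<open>p > 1\<close>.\<close>
  have "((\<lambda>h. norm h powr (p - 1)) \<longlongrightarrow> 0) (at (0::'a))"
  proof (rule tendsto_eq_rhs)
    show "((\<lambda>h::'a. norm h powr (p - 1)) \<longlongrightarrow> norm (0::'a) powr (p - 1)) (at 0)"
      using assms by (intro tendsto_powr2 tendsto_norm) (auto intro: tendsto_eq_intros)
  qed simp
  moreover have "norm h powr (p - 1) = norm h powr p / norm h" for h :: 'a
    by (cases "h = 0") (simp_all add: powr_diff)
  ultimately show ?thesis
    using True by (simp add: has_derivative_at)
next
  case False
  have "((\<lambda>x. norm x powr p) has_derivative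
      (\<lambda>h. norm x powr p * (0 * ln (norm x) + (x \<bullet> h) / norm x * p / norm x))) (at x)"
    using False
    by (intro has_derivative_powr)
      (auto intro!: derivative_eq_intros has_derivative_norm[THEN has_derivative_eq_rhs]
        simp: sgn_div_norm field_simps inner_commute)
  moreover have "norm x powr p = norm x powr (p - 2) * (norm x)\<^sup>2"
    using False by (simp add: powr_diff)
  ultimately show ?thesis
    using False by (simp add: power2_eq_square mult_ac)
qed

text \<open>The subgradient inequality says that \<open>f y - s \<bullet> y\<close> has a global
  minimum at \<open>x\<close>, so its derivative there is zero.\<close>

lemma subgradient_eq_derivative:
  fixes f :: "'a::real_inner \<Rightarrow> real"
  assumes f: "(f has_derivative f') (at x)" and s: "s \<in> subdifferential f x"
  shows "f' h = s \<bullet> h"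
proof -
  have "((\<lambda>y. f y - s \<bullet> y) has_derivative (\<lambda>h. f' h - s \<bullet> h)) (at x)"
    by (intro derivative_intros f)
  moreover have "\<forall>y\<in>UNIV. f x - s \<bullet> x \<le> f y - s \<bullet> y"
    using s by (auto simp: subdifferential_def inner_diff_right algebra_simps)
  ultimately have "(\<lambda>h. f' h - s \<bullet> h) = (\<lambda>h. 0)"
    using differential_zero_maxmin[of x UNIV "\<lambda>y. f y - s \<bullet> y"] by auto
  then show ?thesis
    by (metis eq_iff_diff_eq_0)
qed

text \<open>By orthogonality the cross term vanishes, and squaring doubles the exponents
  \<open>(q - 2) / 2\<close> and turns \<open>sqrt \<nu>\<close> into \<nu>. Thus the hat matrix
  encodes the argument of the root in the potential.\<close>

lemma norm_B_hat_nu_q: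
  assumes "q > 0" "\<nu> \<ge> 0" and W: "transpose W = - W"
  shows "(norm (B_hat_nu_q \<nu> q W B))\<^sup>2
      = norm (sym_part B) powr q + \<nu> * norm (rel_rot W B) powr q"
proof -
  have *: "(t powr ((q - 2) / 2) * t)\<^sup>2 = t powr q" if "t \<ge> 0" for t :: real
  proof (cases "t = 0")
    case False
    have "(t powr ((q - 2) / 2))\<^sup>2 = t powr (q - 2)"
      by (simp add: power2_eq_square flip: powr_add)
    then show ?thesis
      using that False by (simp add: power_mult_distrib powr_diff)
  qed (use assms(1) in simp)
  have "transpose (rel_rot W B) = - rel_rot W B"
    by (simp add: rel_rot_def W)
  from norm_symmetric_plus_antisymmetric[OF transpose_sym_part this]
  show ?thesis
    unfolding B_hat_nu_q_def using *[of "norm (sym_part B)"] *[of "norm (rel_rot W B)"] assms(2)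
    by (simp add: power_mult_distrib mult.assoc)
qed

text \<open>Chain rule: \<open>pos\<close> keeps the argument of the root away from zero, where the
  power \<open>1 / q\<close> fails to be differentiable. The factors \<open>p\<close> and
  \<open>q\<close> produced by the powers cancel against \<open>1 / p\<close> and
  \<open>1 / q\<close>.\<close>

lemma has_derivative_potential:
  fixes B W :: "real^'d^'d"
  assumes pq: "p \<ge> 2" "q \<ge> 2" and "\<nu> \<ge> 0" and W: "transpose W = - W"
    and pos: "norm (sym_part B) powr q + \<nu> * norm (rel_rot W B) powr q > 0"
  shows "(potential p q \<mu>\<^sub>1 \<mu>\<^sub>2 \<nu> \<tau> W has_derivative
      (\<lambda>h. (B_mu_p \<mu>\<^sub>1 \<mu>\<^sub>2 p W B + tau_hat \<tau> \<nu> q *\<^sub>R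
         (B_nu_q \<nu> q W B /\<^sub>R norm (B_hat_nu_q \<nu> q W B) powr (2 * (q - 1) / q))) \<bullet> h)) (at B)"
proof -
  define A where "A = sym_part B"
  define R where "R = rel_rot W B"
  define \<phi> where "\<phi> = norm A powr q + \<nu> * norm R powr q"
  have \<phi>: "\<phi> > 0"
    using pos by (simp add: \<phi>_def A_def R_def)
  have R: "transpose R = - R"
    by (simp add: R_def rel_rot_def W)
  have A: "transpose A = A"
    by (simp add: A_def)
  have dA: "((\<lambda>X. norm (sym_part X) powr r) has_derivative
      (\<lambda>h. r * norm A powr (r - 2) * (A \<bullet> h))) (at B)" if "r \<ge> 2" for r
    using has_derivative_compose[OF bounded_linear_imp_has_derivative[OF bounded_linear_sym_part]
        has_derivative_norm_powr[of r]] that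
    by (simp add: A_def inner_sym_part)
  have "((\<lambda>X. asym_part X - W) has_derivative asym_part) (at B)"
    by (auto intro!: derivative_eq_intros bounded_linear_imp_has_derivative bounded_linear_asym_part)
  from has_derivative_compose[OF this has_derivative_norm_powr]
  have dR: "((\<lambda>X. norm (asym_part X - W) powr r) has_derivative
      (\<lambda>h. r * norm R powr (r - 2) * (R \<bullet> h))) (at B)" if "r \<ge> 2" for r
    using that inner_asym_part[OF R] by (simp add: R_def rel_rot_def)
  have d\<phi>: "((\<lambda>X. norm (sym_part X) powr q + \<nu> * norm (asym_part X - W) powr q) has_derivative
      (\<lambda>h. q * (B_nu_q \<nu> q W B \<bullet> h))) (at B)"
    by (rule derivative_eq_intros dA dR pq refl)+
      (simp add: B_nu_q_def A_def R_def inner_add_left algebra_simps)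
  \<comment> \<open>The exponent is halved by passing to the squared norm; what remains,
    \<open>1 - 1 / q\<close>, is minus the exponent left after differentiating the root.\<close>
  have "norm (B_hat_nu_q \<nu> q W B) powr (2 * (q - 1) / q)
      = ((norm (B_hat_nu_q \<nu> q W B))\<^sup>2) powr ((q - 1) / q)"
    by (simp add: powr_powr flip: powr_numeral)
  also have "(norm (B_hat_nu_q \<nu> q W B))\<^sup>2 = \<phi>"
    using pq assms(3) W by (subst norm_B_hat_nu_q) (simp_all add: \<phi>_def A_def R_def)
  also have "(q - 1) / q = 1 - 1 / q"
    using pq by (simp add: field_simps)
  finally have hat: "norm (B_hat_nu_q \<nu> q W B) powr (2 * (q - 1) / q) = \<phi> powr (1 - 1 / q)" .
  have inv: "inverse (\<phi> powr (1 - 1 / q)) = \<phi> powr (1 / q) / \<phi>"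
    using \<phi> by (simp add: powr_diff)
  have \<phi>_B: "norm (sym_part B) powr q + \<nu> * norm (asym_part B - W) powr q = \<phi>"
    by (simp add: \<phi>_def A_def R_def rel_rot_def)
  have root: "((\<lambda>X. (norm (sym_part X) powr q + \<nu> * norm (asym_part X - W) powr q) powr (1 / q))
      has_derivative (\<lambda>h. inverse (\<phi> powr (1 - 1 / q)) * (B_nu_q \<nu> q W B \<bullet> h))) (at B)"
    using has_derivative_powr[OF d\<phi> has_derivative_const[of "1 / q"]] \<phi> pq
    unfolding inv by (simp add: \<phi>_B)
  show ?thesis
    unfolding potential_def hat
    by (rule derivative_eq_intros dA dR root pq refl)+
      (use pq in \<open>simp add: B_mu_p_def A_def R_def inner_add_left algebra_simps\<close>)
qed

section \<open>The bound where \<open>B_nu\<close> vanishes\<close>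

lemma powr_norm_le_norm2:
  fixes a b :: real
  assumes "a \<ge> 0" "b \<ge> 0" "q \<ge> 2"
  shows "(a powr q + b powr q) powr (1 / q) \<le> sqrt (a\<^sup>2 + b\<^sup>2)"
proof -
  define c where "c = sqrt (a\<^sup>2 + b\<^sup>2)"
  have c: "c \<ge> 0" "c\<^sup>2 = a\<^sup>2 + b\<^sup>2" "a \<le> c" "b \<le> c"
    by (simp_all add: c_def real_le_rsqrt)
  \<comment> \<open>Both \<open>a\<close> and \<open>b\<close> are at most their Euclidean norm
    \<open>c\<close>, so \<open>q - 2\<close> powers of each can be traded for powers of
    \<open>c\<close>; the remaining squares add up to \<open>c\<^sup>2\<close>.\<close>
  have *: "t powr q \<le> c powr (q - 2) * t\<^sup>2" if "0 \<le> t" "t \<le> c" for t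
  proof (cases "t = 0")
    case False
    then have "t powr q = t powr (q - 2) * t\<^sup>2"
      using that by (simp add: powr_diff)
    also have "\<dots> \<le> c powr (q - 2) * t\<^sup>2"
      using that assms by (intro mult_right_mono powr_mono2) auto
    finally show ?thesis .
  qed simp
  have "a powr q + b powr q \<le> c powr (q - 2) * (a\<^sup>2 + b\<^sup>2)"
    using *[of a] *[of b] assms c by (simp add: algebra_simps)
  also have "\<dots> = c powr q"
    using assms c(1) by (cases "c = 0") (simp_all add: powr_diff flip: c(2))
  finally have "(a powr q + b powr q) powr (1 / q) \<le> (c powr q) powr (1 / q)"
    using assms by (intro powr_mono2) auto
  also have "\<dots> = c"
    using assms c(1) by (simp add: powr_powr)
  finally show ?thesis
    by (simp add: c_def)
qed

text \<open>Both weights 1 and \<nu> are at most \<open>max 1 \<nu>\<close>, whose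
  \<open>q\<close>-th root is exactly the denominator in \<open>tau_hat\<close>.\<close>

lemma weighted_powr_norm_le:
  fixes a b :: real
  assumes "a \<ge> 0" "b \<ge> 0" "q \<ge> 2" "\<nu> \<ge> 0"
  shows "(a powr q + \<nu> * b powr q) powr (1 / q) \<le> max 1 (\<nu> powr (1 / q)) * sqrt (a\<^sup>2 + b\<^sup>2)"
proof -
  define m where "m = max 1 \<nu>"
  have m: "m powr (1 / q) = max 1 (\<nu> powr (1 / q))"
    using assms powr_mono2[of "1 / q" 1 \<nu>] powr_mono2[of "1 / q" \<nu> 1] by (auto simp: m_def max_def)
  have "\<nu> * b powr q \<le> m * b powr q" "a powr q \<le> m * a powr q"
    by (auto simp: m_def intro!: mult_right_mono mult_le_cancel_right1[THEN iffD2])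
  then have "(a powr q + \<nu> * b powr q) powr (1 / q) \<le> (m * (a powr q + b powr q)) powr (1 / q)"
    using assms by (intro powr_mono2) (auto simp: algebra_simps)
  also have "\<dots> = max 1 (\<nu> powr (1 / q)) * (a powr q + b powr q) powr (1 / q)"
    by (simp add: powr_mult m_def flip: m)
  also have "\<dots> \<le> max 1 (\<nu> powr (1 / q)) * sqrt (a\<^sup>2 + b\<^sup>2)"
    using assms by (intro mult_left_mono powr_norm_le_norm2) auto
  finally show ?thesis .
qed

text \<open>The inequality is tested along the ray \<open>B + t *\<^sub>R S\<close>. The assumption
  \<open>rot\<close> ensures that the rotational terms either scale with \<open>t\<close> or carry
  zero coefficients, so the potential splits into terms of degree \<open>p\<close> and 1 in
  \<open>t\<close>.\<close>

lemma subgradient_norm_le: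
  fixes S B W :: "real^'d^'d"
  assumes pq: "p \<ge> 2" "q \<ge> 2" and nonneg: "\<nu> \<ge> 0" "\<tau> \<ge> 0"
    and sub: "S \<in> subdifferential (potential p q \<mu>\<^sub>1 \<mu>\<^sub>2 \<nu> \<tau> W) B"
    and sym: "sym_part B = 0" and rot: "rel_rot W B = 0 \<or> (\<nu> = 0 \<and> \<mu>\<^sub>2 = 0)"
  shows "norm S \<le> \<tau>"
proof -
  define a b where "a = norm (sym_part S)" and "b = norm (asym_part S)"
  define C where "C = \<mu>\<^sub>1 / p * a powr p + \<mu>\<^sub>2 / p * b powr p"
  define N where "N = tau_hat \<tau> \<nu> q * (a powr q + \<nu> * b powr q) powr (1 / q)"
  have norm_S: "(norm S)\<^sup>2 = a\<^sup>2 + b\<^sup>2"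
    using norm_symmetric_plus_antisymmetric[of "sym_part S" "asym_part S" 1 1]
    by (simp add: sym_part_plus_asym_part a_def b_def)
  have sB: "sym_part (B + t *\<^sub>R S) = t *\<^sub>R sym_part S" for t
    using sym by (simp add: linear_simps[OF bounded_linear_sym_part])
  have aB: "asym_part (B + t *\<^sub>R S) - W = rel_rot W B + t *\<^sub>R asym_part S" for t
    by (simp add: rel_rot_def linear_simps[OF bounded_linear_asym_part])
  have V: "potential p q \<mu>\<^sub>1 \<mu>\<^sub>2 \<nu> \<tau> W (B + t *\<^sub>R S) = t powr p * C + t * N" if "t \<ge> 0" for t
  proof -
    have "((t * a) powr q + \<nu> * (t * b) powr q) powr (1 / q)
        = (t powr q * (a powr q + \<nu> * b powr q)) powr (1 / q)"
      using that by (simp add: powr_mult a_def b_def algebra_simps)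
    also have "\<dots> = t * (a powr q + \<nu> * b powr q) powr (1 / q)"
      using that pq nonneg by (simp add: powr_mult powr_powr)
    finally have root: "((t * a) powr q + \<nu> * (t * b) powr q) powr (1 / q)
        = t * (a powr q + \<nu> * b powr q) powr (1 / q)" .
    have "potential p q \<mu>\<^sub>1 \<mu>\<^sub>2 \<nu> \<tau> W (B + t *\<^sub>R S)
        = \<mu>\<^sub>1 / p * (t * a) powr p + \<mu>\<^sub>2 / p * (t * b) powr p
          + tau_hat \<tau> \<nu> q * ((t * a) powr q + \<nu> * (t * b) powr q) powr (1 / q)"
      using that rot by (auto simp: potential_def sB aB a_def b_def)
    then show ?thesis
      unfolding root using that by (simp add: C_def N_def powr_mult a_def b_def algebra_simps)
  qed
  \<comment> \<open>The formula for \<open>V\<close> also covers \<open>t = 0\<close>, since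
    \<open>0 powr p = 0\<close>.\<close>
  have V0: "potential p q \<mu>\<^sub>1 \<mu>\<^sub>2 \<nu> \<tau> W B = 0"
    using V[of 0] pq by simp
  have "(norm S)\<^sup>2 \<le> t powr (p - 1) * C + N" if "t > 0" for t
  proof -
    have "S \<bullet> ((B + t *\<^sub>R S) - B)
        \<le> potential p q \<mu>\<^sub>1 \<mu>\<^sub>2 \<nu> \<tau> W (B + t *\<^sub>R S) - potential p q \<mu>\<^sub>1 \<mu>\<^sub>2 \<nu> \<tau> W B"
      using sub unfolding subdifferential_def by blast
    moreover have "t powr p = t * t powr (p - 1)"
      using that by (simp add: powr_diff)
    ultimately have "t * (norm S)\<^sup>2 \<le> t * (t powr (p - 1) * C + N)"
      using that by (simp add: V V0 power2_norm_eq_inner algebra_simps)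
    then show ?thesis
      using that by simp
  qed
  then have "\<forall>\<^sub>F t in at_right 0. (norm S)\<^sup>2 \<le> t powr (p - 1) * C + N"
    by (auto simp: eventually_at_right_less intro: eventually_mono[OF eventually_at_right_less])
  \<comment> \<open>The term with \<open>C\<close> disappears in the limit because
    \<open>p - 1 > 0\<close>; only the one-homogeneous part \<open>N\<close> survives.\<close>
  moreover have "((\<lambda>t. t powr (p - 1) * C + N) \<longlongrightarrow> 0 powr (p - 1) * C + N) (at_right 0)"
    using pq by (intro tendsto_intros tendsto_powr2) (auto intro: eventually_mono[OF eventually_at_right_less])
  ultimately have "(norm S)\<^sup>2 \<le> N"
    using tendsto_lowerbound[of _ _ "at_right (0::real)"] by fastforce
  also have "N \<le> tau_hat \<tau> \<nu> q * (max 1 (\<nu> powr (1 / q)) * sqrt (a\<^sup>2 + b\<^sup>2))"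
    unfolding N_def using pq nonneg
    by (intro mult_left_mono weighted_powr_norm_le) (auto simp: a_def b_def tau_hat_def)
  also have "\<dots> = \<tau> * norm S"
    by (simp add: tau_hat_def flip: norm_S)
  \<comment> \<open>For nonzero \<open>S\<close> one factor \<open>norm S\<close> cancels; for
    \<open>S = 0\<close> the bound is the sign of \<tau>.\<close>
  finally show ?thesis
    by (cases "S = 0") (simp_all add: power2_eq_square nonneg)
qed

section \<open>The case distinction on \<open>B_nu\<close> and the almost everywhere
  statement\<close>

lemma B_nu_eq_0_iff:
  fixes B W :: "real^'d^'d"
  assumes W: "transpose W = - W"
  shows "B_nu \<nu> W B = 0 \<longleftrightarrow> sym_part B = 0 \<and> (\<nu> = 0 \<or> rel_rot W B = 0)"
proof -
  have "transpose (rel_rot W B) = - rel_rot W B"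
    by (simp add: rel_rot_def W)
  from norm_symmetric_plus_antisymmetric[OF transpose_sym_part this, of 1 B \<nu>]
  have "(norm (B_nu \<nu> W B))\<^sup>2 = (norm (sym_part B))\<^sup>2 + (\<nu> * norm (rel_rot W B))\<^sup>2"
    by (simp add: B_nu_def)
  then have "B_nu \<nu> W B = 0 \<longleftrightarrow> (norm (sym_part B))\<^sup>2 + (\<nu> * norm (rel_rot W B))\<^sup>2 = 0"
    by (metis norm_eq_zero power_eq_0_iff zero_neq_numeral power_zero_numeral)
  then show ?thesis
    by (simp add: sum_power2_eq_zero_iff)
qed

theorem corollary3p8:
  fixes U :: "(real^'d) set"
    and T p q \<mu>\<^sub>1 \<mu>\<^sub>2 \<nu> \<tau> :: real
    and \<Omega> B S :: "(real^'d) \<times> real \<Rightarrow> real^'d^'d"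
    and v :: "(real^'d) \<times> real \<Rightarrow> real^'d"
  assumes domain: "open U" "connected U" "U \<noteq> {}" "bounded U"
    and T: "T > 0"
    and exponents: "p \<ge> 2" "q \<ge> 2"
    and coefficients: "\<mu>\<^sub>1 > 0" "\<mu>\<^sub>2 \<ge> 0" "\<nu> \<ge> 0" "\<tau> \<ge> 0"
    and antisymmetric: "\<forall>z \<in> U \<times> {0<..<T}. transpose (\<Omega> z) = - \<Omega> z"
    and gradient: "spatial_gradient_on (U \<times> {0<..<T}) v B"
    and inclusion: "AE z in lebesgue_on (U \<times> {0<..<T}).
          S z \<in> subdifferential (potential p q \<mu>\<^sub>1 \<mu>\<^sub>2 \<nu> \<tau> (\<Omega> z)) (B z)"
    and nondegenerate: "\<nu> > 0 \<or> (\<nu> = 0 \<and> \<mu>\<^sub>2 = 0)"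
  shows "AE z in lebesgue_on (U \<times> {0<..<T}).
      (B_nu \<nu> (\<Omega> z) (B z) \<noteq> 0 \<longrightarrow>
         S z = B_mu_p \<mu>\<^sub>1 \<mu>\<^sub>2 p (\<Omega> z) (B z)
               + tau_hat \<tau> \<nu> q *\<^sub>R
                 (B_nu_q \<nu> q (\<Omega> z) (B z)
                    /\<^sub>R norm (B_hat_nu_q \<nu> q (\<Omega> z) (B z)) powr (2 * (q - 1) / q)))
      \<and> (B_nu \<nu> (\<Omega> z) (B z) = 0 \<longrightarrow> norm (S z) \<le> \<tau>)"
proof -
  have pointwise: "(B_nu \<nu> W X \<noteq> 0 \<longrightarrow>
         Y = B_mu_p \<mu>\<^sub>1 \<mu>\<^sub>2 p W X
             + tau_hat \<tau> \<nu> q *\<^sub>R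
               (B_nu_q \<nu> q W X /\<^sub>R norm (B_hat_nu_q \<nu> q W X) powr (2 * (q - 1) / q)))
      \<and> (B_nu \<nu> W X = 0 \<longrightarrow> norm Y \<le> \<tau>)"
    if W: "transpose W = - W" and Y: "Y \<in> subdifferential (potential p q \<mu>\<^sub>1 \<mu>\<^sub>2 \<nu> \<tau> W) X"
    for W X Y :: "real^'d^'d"
  proof (intro conjI impI)
    assume "B_nu \<nu> W X \<noteq> 0"
    \<comment> \<open>Either the symmetric part is nonzero, or both \<nu> and the relative rotation
      are; in each case one summand is positive.\<close>
    then have "norm (sym_part X) powr q + \<nu> * norm (rel_rot W X) powr q > 0"
      using coefficients by (auto simp: B_nu_eq_0_iff[OF W] intro: add_pos_nonneg add_nonneg_pos)
    from subgradient_eq_derivative[OF has_derivative_potential[OF exponents coefficients(3) W this] Y]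
    show "Y = B_mu_p \<mu>\<^sub>1 \<mu>\<^sub>2 p W X + tau_hat \<tau> \<nu> q *\<^sub>R
        (B_nu_q \<nu> q W X /\<^sub>R norm (B_hat_nu_q \<nu> q W X) powr (2 * (q - 1) / q))"
      by (metis vector_eq_rdot)
  next
    assume "B_nu \<nu> W X = 0"
    \<comment> \<open>If \<nu> is positive, the relative rotation vanishes; otherwise
      \<open>nondegenerate\<close> gives \<open>\<mu>\<^sub>2 = 0\<close>, and the potential does
      not see the rotation.\<close>
    then show "norm Y \<le> \<tau>"
      using nondegenerate B_nu_eq_0_iff[OF W]
      by (intro subgradient_norm_le[OF exponents coefficients(3,4) Y]) auto
  qed
  \<comment> \<open>Antisymmetry of \<open>\<Omega> z\<close> is given only inside the cylinder, so
    membership has to accompany the inclusion.\<close>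
  have "AE z in lebesgue_on (U \<times> {0<..<T}). z \<in> U \<times> {0<..<T}"
    by (rule AE_I2) simp
  with inclusion show ?thesis
  proof eventually_elim
    case (elim z)
    then show ?case
      using pointwise[of "\<Omega> z" "S z" "B z"] antisymmetric by blast
  qed
qed

end
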